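(* Let $S$ be a round and basic $\vee$-semilattice. Then for all $p,q\in S$, $$p\prec q\quad\Leftrightarrow\quad\forall s\in S\text{ with }s\nleq q\ \ \exists f\in S\ (\{f,p\}\text{ is far and }s\leq f\vee q).$$
   Context: A $\vee$-semilattice is a non-empty poset in which any two elements $p,q$ have a supremum $p\vee q$. A non-empty finite $F\subseteq S$ is far if for all $p,q\in S$: if $p\leq q\vee f$ for all $f\in F$, then $p\leq q$. The rather below relation on $S$ is defined by: $p\prec q$ iff for all $s\in S$ with $s\nleq q$ there is a finite $F\subseteq S$ such that $F\cup\{p\}$ is far and $s\leq f\vee q$ for all $f\in F$. $S$ is round if for every $p\in S$ there is $q\in S$ with $p\prec q$. $S$ is basic if for all $p,q,s,t\in S$: $t\prec q\vee s$ and $t\prec p\vee s$ imply that there is $r\in S$ with $r\leq p$, $r\leq q$ and $t\prec r\vee s$. *)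

theory Defs
  imports Main
begin

(* The semilattice S is the whole type; types are inhabited, so S is non-empty. *)

context semilattice_sup
begin

definition far :: "'a set \<Rightarrow> bool" where
  "far F \<longleftrightarrow> finite F \<and> F \<noteq> {} \<and>
     (\<forall>p q. (\<forall>f\<in>F. p \<le> sup q f) \<longrightarrow> p \<le> q)"

(* F itself may be empty: only F \<union> {p} has to be non-empty. *)
definition rather_below :: "'a \<Rightarrow> 'a \<Rightarrow> bool" (infix "\<prec>" 50) where
  "p \<prec> q \<longleftrightarrow>
     (\<forall>s. \<not> s \<le> q \<longrightarrow>
        (\<exists>F. finite F \<and> far (F \<union> {p}) \<and> (\<forall>f\<in>F. s \<le> sup f q)))"

end

class round_semilattice_sup = semilattice_sup +
  assumes round: "\<exists>q. p \<prec> q"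

class basic_semilattice_sup = semilattice_sup +
  assumes basic: "t \<prec> sup q s \<Longrightarrow> t \<prec> sup p s \<Longrightarrow>
    \<exists>r. r \<le> p \<and> r \<le> q \<and> t \<prec> sup r s"

end

theory Submission imports Defs begin

text \<open>
  For the forward direction, let \<open>p \<prec> q\<close> and \<open>\<not> s \<le> q\<close>. Roundness enlarges \<open>s\<close> to some \<open>t\<close> with
  \<open>s \<prec> t\<close>, and \<open>p \<prec> q\<close> applied to \<open>t\<close> yields a finite \<open>F\<close> such that \<open>F \<union> {p}\<close> is far and
  \<open>s \<prec> t \<le> sup f q\<close> for all \<open>f \<in> F\<close>. As \<open>s\<close> is now rather below each \<open>sup f q\<close>, basicness
  replaces \<open>F\<close> by a single lower bound \<open>r\<close> with \<open>s \<prec> sup r q\<close>, and passing to a lower bound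
  preserves farness.
\<close>

context semilattice_sup
begin

lemma farD:
  assumes "far F" "\<And>f. f \<in> F \<Longrightarrow> p \<le> sup q f"
  shows "p \<le> q"
  using assms unfolding far_def by blast

text \<open>If \<open>g \<le> f\<close>, then \<open>p \<le> sup q g\<close> gives
  \<open>p \<le> sup q f\<close>, so whatever passes the test for \<open>G\<close> passes it for
  \<open>F\<close>. Enlarging a far set is the case \<open>F \<subseteq> G\<close>.\<close>

lemma far_refine:
  assumes "far F" "finite G" and refine: "\<And>f. f \<in> F \<Longrightarrow> \<exists>g\<in>G. g \<le> f"
  shows "far G"
  unfolding far_def
proof (intro conjI allI impI)
  show "G \<noteq> {}"
    using \<open>far F\<close> refine unfolding far_def by blast
  fix p q
  assume le: "\<forall>g\<in>G. p \<le> sup q g"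
  have "p \<le> sup q f" if "f \<in> F" for f
  proof -
    obtain g where g: "g \<in> G" "g \<le> f"
      using refine \<open>f \<in> F\<close> by blast
    then have "sup q g \<le> sup q f"
      by (intro sup_mono order_refl)
    then show ?thesis
      using le g order_trans by blast
  qed
  then show "p \<le> q"
    by (rule farD[OF \<open>far F\<close>])
qed fact

text \<open>Otherwise \<open>s = p\<close> may be tested in the definition; the remaining element
  \<open>p\<close> of \<open>F \<union> {p}\<close> satisfies \<open>p \<le> sup q p\<close>
  trivially.\<close>

lemma rather_below_imp_le:
  assumes "p \<prec> q"
  shows "p \<le> q"
proof (rule ccontr)
  assume "\<not> p \<le> q"
  then obtain F where "far (F \<union> {p})" "\<forall>f\<in>F. p \<le> sup f q"
    using assms unfolding rather_below_def by blast
  then have "p \<le> q"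
    by (auto intro: farD simp: sup_commute)
  with \<open>\<not> p \<le> q\<close> show False ..
qed

lemma rather_below_le_trans:
  assumes "p \<prec> q" "q \<le> q'"
  shows "p \<prec> q'"
  unfolding rather_below_def
proof (intro allI impI)
  fix s
  assume "\<not> s \<le> q'"
  then have "\<not> s \<le> q"
    using \<open>q \<le> q'\<close> order_trans by blast
  then obtain F where F: "finite F" "far (F \<union> {p})" "\<forall>f\<in>F. s \<le> sup f q"
    using \<open>p \<prec> q\<close> unfolding rather_below_def by blast
  moreover have "sup f q \<le> sup f q'" for f
    using \<open>q \<le> q'\<close> by (intro sup_mono order_refl)
  ultimately show "\<exists>F. finite F \<and> far (F \<union> {p}) \<and> (\<forall>f\<in>F. s \<le> sup f q')"
    using order_trans by blast
qed

end

lemma (in basic_semilattice_sup) basic_finite: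
  assumes "finite F" "F \<noteq> {}" "\<And>f. f \<in> F \<Longrightarrow> t \<prec> sup f s"
  shows "\<exists>r. (\<forall>f\<in>F. r \<le> f) \<and> t \<prec> sup r s"
  using assms
proof (induction rule: finite_ne_induct)
  case (singleton x)
  then show ?case by auto
next
  case (insert x F)
  then obtain r where r: "\<forall>f\<in>F. r \<le> f" "t \<prec> sup r s"
    by auto
  moreover have "t \<prec> sup x s"
    using insert.prems by simp
  ultimately obtain r' where "r' \<le> x" "r' \<le> r" "t \<prec> sup r' s"
    using basic by blast
  with r show ?case
    by (auto intro: order_trans)
qed

theorem theorem6p4:
  fixes p q :: "'a :: {round_semilattice_sup, basic_semilattice_sup}"
  shows "p \<prec> q \<longleftrightarrow>
    (\<forall>s. \<not> s \<le> q \<longrightarrow> (\<exists>f. far {f, p} \<and> s \<le> sup f q))"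
proof (intro iffI allI impI)
  fix s
  assume "p \<prec> q" "\<not> s \<le> q"
  obtain t where "s \<prec> t"
    using round by blast
  then have "\<not> t \<le> q"
    using \<open>\<not> s \<le> q\<close> rather_below_imp_le order_trans by blast
  then obtain F where F: "finite F" "far (F \<union> {p})" "\<forall>f\<in>F. t \<le> sup f q"
    using \<open>p \<prec> q\<close> unfolding rather_below_def by blast
  show "\<exists>f. far {f, p} \<and> s \<le> sup f q"
  proof (cases "F = {}")
    case True
    \<comment> \<open>Here \<open>{p}\<close> alone is far, so any partner will do; \<open>s\<close>
      itself lies below \<open>sup s q\<close>.\<close>
    then have "far {s, p}"
      using far_refine[OF F(2), of "{s, p}"] by simp
    then show ?thesis
      by (blast intro: sup_ge1)
  next
    case False
    have "s \<prec> sup f q" if "f \<in> F" for f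
      using \<open>s \<prec> t\<close> F(3) that by (blast intro: rather_below_le_trans)
    then obtain r where r: "\<forall>f\<in>F. r \<le> f" "s \<prec> sup r q"
      using basic_finite[OF F(1) False] by blast
    \<comment> \<open>Each \<open>f \<in> F\<close> is refined by \<open>r\<close>, and
      \<open>p\<close> by itself.\<close>
    have "far {r, p}"
      using F(2) by (rule far_refine) (use r in auto)
    then show ?thesis
      using r rather_below_imp_le by blast
  qed
next
  assume single: "\<forall>s. \<not> s \<le> q \<longrightarrow> (\<exists>f. far {f, p} \<and> s \<le> sup f q)"
  show "p \<prec> q"
    unfolding rather_below_def
  proof (intro allI impI)
    fix s
    assume "\<not> s \<le> q"
    then obtain f where "far {f, p}" "s \<le> sup f q"
      using single by blast
    then show "\<exists>F. finite F \<and> far (F \<union> {p}) \<and> (\<forall>f\<in>F. s \<le> sup f q)"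
      by (intro exI[of _ "{f}"]) (simp add: insert_commute)
  qed
qed

end
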